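(* Let $\beta\in\mathbb{R}\setminus\{0\}$ and let $\Gamma=\langle\mathcal{H}_\beta\rangle$ be the discrete subgroup of $O(1,1)$ generated by the hyperbolic rotation $\mathcal{H}_\beta$, acting linearly on $\mathbb{R}^{1,1}=\mathbb{R}^2$. Let $\rho(x,y)=x^2-y^2$ be the generator of the invariant ring $\mathcal{P}(\mathbb{R}^{1,1})^\Gamma$. Then the pullback map $\rho^*:\mathcal{E}(\mathbb{R})\to\mathcal{E}(\mathbb{R}^2)^\Gamma$, $\rho^*(f)=f\circ\rho$, is not surjective; that is, $$\rho^*\mathcal{E}(\mathbb{R})\subsetneq\mathcal{E}(\mathbb{R}^2)^\Gamma.$$
   Context: The hyperbolic rotation is $$\mathcal{H}_\beta=\begin{bmatrix}\cosh\beta&\sinh\beta\\ \sinh\beta&\cosh\beta\end{bmatrix}.$$ $\mathbb{R}^{1,1}$ is $\mathbb{R}^2$ with the quadratic form $x^2-y^2$, and $O(1,1)$ is the group of invertible linear maps preserving it. $\mathcal{P}(\mathbb{R}^{1,1})^\Gamma$ is the ring of $\Gamma$-invariant real polynomials in $x,y$; it equals $\mathbb{R}[x^2-y^2]$. $\mathcal{E}(\mathbb{R}^k)$ is the algebra of real-valued smooth ($C^\infty$) functions on $\mathbb{R}^k$, and $\mathcal{E}(\mathbb{R}^2)^\Gamma$ is the subalgebra of $\Gamma$-invariant ones. *)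

theory Defs
  imports "HOL-Analysis.Analysis" "HOL-Algebra.Generated_Groups"
begin

(* Same recursion as higher_differentiable_on of the AFP entry Smooth_Manifolds, on the whole space:
   for n > 0 the function is differentiable and each directional derivative is of class C^(n-1). *)
primrec class_C :: "nat \<Rightarrow> ('a::euclidean_space \<Rightarrow> real) \<Rightarrow> bool" where
  "class_C 0 f \<longleftrightarrow> continuous_on UNIV f"
| "class_C (Suc n) f \<longleftrightarrow>
     (\<forall>x. f differentiable (at x)) \<and> (\<forall>v. class_C n (\<lambda>x. frechet_derivative f (at x) v))"

definition smooth_functions :: "('a::euclidean_space \<Rightarrow> real) set" where
  "smooth_functions = {f. \<forall>n. class_C n f}"

definition rho :: "real^2 \<Rightarrow> real" where
  "rho v = (v $ 1)\<^sup>2 - (v $ 2)\<^sup>2"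

(* Linear maps are identified with their matrices in the standard basis, acting by *v. *)
definition O11 :: "(real^2^2) monoid" where
  "O11 = \<lparr>carrier = {A. invertible A \<and> (\<forall>v. rho (A *v v) = rho v)}, mult = (**), one = mat 1\<rparr>"

definition hyperbolic_rotation :: "real \<Rightarrow> real^2^2" where
  "hyperbolic_rotation \<beta> = vector [vector [cosh \<beta>, sinh \<beta>], vector [sinh \<beta>, cosh \<beta>]]"

definition hyperbolic_group :: "real \<Rightarrow> (real^2^2) set" where
  "hyperbolic_group \<beta> = generate O11 {hyperbolic_rotation \<beta>}"

definition invariant_functions :: "(real^'n^'n) set \<Rightarrow> (real^'n \<Rightarrow> real) set" where
  "invariant_functions G = {f. \<forall>A\<in>G. \<forall>v. f (A *v v) = f v}"

definition pullback :: "('a \<Rightarrow> 'b) \<Rightarrow> ('b \<Rightarrow> 'c) \<Rightarrow> 'a \<Rightarrow> 'c" where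
  "pullback \<phi> f = f \<circ> \<phi>"

lemma group_O11: "group O11"
proof (rule groupI)
  fix A B assume "A \<in> carrier O11" "B \<in> carrier O11"
  then show "A \<otimes>\<^bsub>O11\<^esub> B \<in> carrier O11"
    by (auto simp: O11_def invertible_mult simp flip: matrix_vector_mul_assoc)
next
  fix A assume A: "A \<in> carrier O11"
  then obtain B where I: "A ** B = mat 1" "B ** A = mat 1"
    by (auto simp: O11_def invertible_def)
  have rhoA: "rho (A *v v) = rho v" for v using A by (simp add: O11_def)
  have "rho (B *v v) = rho v" for v
    using rhoA[of "B *v v"] I by (simp add: matrix_vector_mul_assoc)
  moreover have "invertible B" using I unfolding invertible_def by blast
  ultimately show "\<exists>B\<in>carrier O11. B \<otimes>\<^bsub>O11\<^esub> A = \<one>\<^bsub>O11\<^esub>"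
    using I by (auto simp: O11_def)
qed (auto simp: O11_def matrix_mul_assoc invertible_def intro: exI[of _ "mat 1"])

lemma hyperbolic_rotation_mult:
  "hyperbolic_rotation a ** hyperbolic_rotation b = hyperbolic_rotation (a + b)"
  by (simp add: vec_eq_iff forall_2 matrix_matrix_mult_def sum_2 hyperbolic_rotation_def
      cosh_add sinh_add algebra_simps)

lemma hyperbolic_rotation_0: "hyperbolic_rotation 0 = mat 1"
  by (simp add: vec_eq_iff forall_2 hyperbolic_rotation_def mat_def)

lemma hyperbolic_rotation_in_O11: "hyperbolic_rotation b \<in> carrier O11"
proof -
  have "invertible (hyperbolic_rotation b)"
    unfolding invertible_def
    by (rule exI[of _ "hyperbolic_rotation (-b)"])
       (simp add: hyperbolic_rotation_mult hyperbolic_rotation_0)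
  moreover have "rho (hyperbolic_rotation b *v v) = rho v" for v
  proof -
    have "rho (hyperbolic_rotation b *v v) = ((cosh b)\<^sup>2 - (sinh b)\<^sup>2) * rho v"
      by (simp add: rho_def matrix_vector_mult_def hyperbolic_rotation_def sum_2
          power2_eq_square algebra_simps)
    also have "\<dots> = rho v" by (simp add: hyperbolic_pythagoras)
    finally show ?thesis .
  qed
  ultimately show ?thesis by (simp add: O11_def)
qed

lemma subgroup_hyperbolic_group: "subgroup (hyperbolic_group \<beta>) O11"
  unfolding hyperbolic_group_def
  by (rule group.generate_is_subgroup[OF group_O11]) (simp add: hyperbolic_rotation_in_O11)

lemma hyperbolic_group_eq: "hyperbolic_group \<beta> = range (\<lambda>k::int. hyperbolic_rotation (of_int k * \<beta>))"
proof -
  interpret group O11 by (rule group_O11)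
  have inv: "inv\<^bsub>O11\<^esub> hyperbolic_rotation b = hyperbolic_rotation (-b)" for b
    by (rule inv_equality)
       (use hyperbolic_rotation_in_O11 in
         \<open>simp_all add: O11_def hyperbolic_rotation_mult hyperbolic_rotation_0\<close>)
  have npow: "hyperbolic_rotation \<beta> [^]\<^bsub>O11\<^esub> n = hyperbolic_rotation (of_nat n * \<beta>)" for n :: nat
  proof (induction n)
    case 0
    show ?case by (simp add: hyperbolic_rotation_0) (simp add: O11_def)
  next
    case (Suc n)
    then show ?case
      by (simp add: O11_def hyperbolic_rotation_mult algebra_simps)
  qed
  have "hyperbolic_rotation \<beta> [^]\<^bsub>O11\<^esub> k = hyperbolic_rotation (of_int k * \<beta>)" for k :: int
    by (cases k rule: int_cases2)
       (simp_all add: int_pow_int int_pow_neg_int hyperbolic_rotation_in_O11 npow inv)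
  moreover have "hyperbolic_group \<beta> = {hyperbolic_rotation \<beta> [^]\<^bsub>O11\<^esub> k |k. k \<in> (UNIV::int set)}"
    unfolding hyperbolic_group_def using generate_pow[OF hyperbolic_rotation_in_O11] .
  ultimately show ?thesis by auto
qed

lemma discrete_hyperbolic_group: "discrete (hyperbolic_group \<beta>)"
proof -
  have lip: "\<bar>x - y\<bar> \<le> \<bar>sinh x - sinh y\<bar>" for x y :: real
  proof -
    have "y - x \<le> sinh y - sinh x" if "x \<le> y" for x y :: real
    proof -
      have "\<exists>z::real. z \<ge> x \<and> z \<le> y \<and> sinh y - sinh x = (y - x) * cosh z" if "x < y"
      proof -
        have "\<exists>z::real. x < z \<and> z < y \<and> sinh y - sinh x = (y - x) * cosh z"
          by (rule MVT2[OF that]) (auto intro!: derivative_eq_intros)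
        then show ?thesis by (meson less_imp_le)
      qed
      then show ?thesis
        using that cosh_real_ge_1 by (cases "x = y") (auto intro: mult_le_cancel_left1[THEN iffD2])
    qed
    from this[of x y] this[of y x] show ?thesis by (cases "x \<le> y") auto
  qed
  have far: "\<bar>x - y\<bar> \<le> dist (hyperbolic_rotation x) (hyperbolic_rotation y)" for x y
  proof -
    have "\<bar>sinh x - sinh y\<bar> = dist (hyperbolic_rotation x $ 1 $ 2) (hyperbolic_rotation y $ 1 $ 2)"
      by (simp add: hyperbolic_rotation_def dist_real_def)
    also have "\<dots> \<le> dist (hyperbolic_rotation x $ 1) (hyperbolic_rotation y $ 1)"
      by (rule dist_vec_nth_le)
    also have "\<dots> \<le> dist (hyperbolic_rotation x) (hyperbolic_rotation y)"
      by (rule dist_vec_nth_le)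
    finally show ?thesis using lip[of x y] by linarith
  qed
  have "uniform_discrete (hyperbolic_group \<beta>)"
  proof (cases "\<beta> = 0")
    case True
    then show ?thesis by (auto simp: hyperbolic_group_eq uniform_discrete_def intro: exI[of _ 1])
  next
    case False
    have "k = l" if "dist (hyperbolic_rotation (of_int k * \<beta>)) (hyperbolic_rotation (of_int l * \<beta>)) < \<bar>\<beta>\<bar>"
      for k l :: int
    proof -
      have "\<bar>of_int (k - l)\<bar> * \<bar>\<beta>\<bar> < 1 * \<bar>\<beta>\<bar>"
        using that far[of "of_int k * \<beta>" "of_int l * \<beta>"]
        by (simp add: abs_mult[symmetric] algebra_simps)
      then have "\<bar>of_int (k - l) :: real\<bar> < 1" by (simp only: mult_less_cancel_right)
      then have "\<bar>k - l\<bar> < 1" by linarith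
      then show ?thesis by simp
    qed
    then show ?thesis
      using False by (auto simp: hyperbolic_group_eq uniform_discrete_def intro!: exI[of _ "\<bar>\<beta>\<bar>"])
  qed
  then show ?thesis by (rule uniform_discrete_imp_discrete)
qed

lemma real_polynomial_function_line:
  assumes "real_polynomial_function p"
  shows "\<exists>q. \<forall>s. p (s *\<^sub>R c + d) = poly q s"
  using assms
proof induction
  case (linear f)
  interpret bounded_linear f by fact
  show ?case by (rule exI[of _ "[:f d, f c:]"]) (simp add: add scaleR)
next
  case (const k)
  show ?case by (rule exI[of _ "[:k:]"]) simp
next
  case (add f g)
  then obtain q r where "\<forall>s. f (s *\<^sub>R c + d) = poly q s" "\<forall>s. g (s *\<^sub>R c + d) = poly r s" by blast
  then show ?case by (intro exI[of _ "q + r"]) simp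
next
  case (mult f g)
  then obtain q r where "\<forall>s. f (s *\<^sub>R c + d) = poly q s" "\<forall>s. g (s *\<^sub>R c + d) = poly r s" by blast
  then show ?case by (intro exI[of _ "q * r"]) simp
qed

lemma real_polynomial_function_hyperbola:
  assumes "real_polynomial_function p"
  shows "\<exists>N q. \<forall>t. t \<noteq> 0 \<longrightarrow> t ^ N * p (t *\<^sub>R c + inverse t *\<^sub>R d) = poly q t"
  using assms
proof induction
  case (linear f)
  interpret bounded_linear f by fact
  show ?case by (rule exI[of _ 1], rule exI[of _ "[:f d, 0, f c:]"]) (simp add: add scaleR field_simps)
next
  case (const k)
  show ?case by (rule exI[of _ 0], rule exI[of _ "[:k:]"]) simp
next
  case (add f g)
  then obtain M N q r where
    fq: "\<And>t. t \<noteq> 0 \<Longrightarrow> t ^ M * f (t *\<^sub>R c + inverse t *\<^sub>R d) = poly q t" and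
    gr: "\<And>t. t \<noteq> 0 \<Longrightarrow> t ^ N * g (t *\<^sub>R c + inverse t *\<^sub>R d) = poly r t" by blast
  show ?case
    by (intro exI[of _ "M + N"] exI[of _ "monom 1 N * q + monom 1 M * r"])
       (auto simp: poly_monom power_add algebra_simps simp flip: fq gr)
next
  case (mult f g)
  then obtain M N q r where
    fq: "\<And>t. t \<noteq> 0 \<Longrightarrow> t ^ M * f (t *\<^sub>R c + inverse t *\<^sub>R d) = poly q t" and
    gr: "\<And>t. t \<noteq> 0 \<Longrightarrow> t ^ N * g (t *\<^sub>R c + inverse t *\<^sub>R d) = poly r t" by blast
  show ?case
    by (intro exI[of _ "M + N"] exI[of _ "q * r"])
       (auto simp: power_add algebra_simps simp flip: fq gr)
qed

lemma pullback_rho_invariant: "pullback rho f \<in> invariant_functions (hyperbolic_group \<beta>)"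
  using subgroup.subset[OF subgroup_hyperbolic_group, of \<beta>]
  by (auto simp: pullback_def invariant_functions_def O11_def)

lemma real_polynomial_function_pullback_rho: "real_polynomial_function (pullback rho (poly q))"
proof -
  have nth: "real_polynomial_function (\<lambda>v::real^2. v $ i)" for i
    by (rule real_polynomial_function.intros(1)) (rule bounded_linear_vec_nth)
  have r: "real_polynomial_function rho"
    unfolding rho_def[abs_def] by (intro real_polynomial_function_diff real_polynomial_function_power nth)
  show ?thesis
  proof (induction q)
    case 0
    then show ?case
      using real_polynomial_function.intros(2)[of 0] by (simp add: pullback_def comp_def)
  next
    case (pCons a q)
    then have "real_polynomial_function (\<lambda>v. a + rho v * pullback rho (poly q) v)"
      by (intro real_polynomial_function.intros(2-4) r)
    then show ?case by (simp add: pullback_def comp_def)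
  qed
qed

lemma invariant_polynomials_eq:
  assumes "\<beta> \<noteq> 0"
  shows "{p. real_polynomial_function p} \<inter> invariant_functions (hyperbolic_group \<beta>) = range (\<lambda>q. pullback rho (poly q))"
proof (intro equalityI subsetI)
  fix f assume "f \<in> range (\<lambda>q. pullback rho (poly q))"
  then show "f \<in> {p. real_polynomial_function p} \<inter> invariant_functions (hyperbolic_group \<beta>)"
    using real_polynomial_function_pullback_rho pullback_rho_invariant by auto
next
  fix p assume "p \<in> {p. real_polynomial_function p} \<inter> invariant_functions (hyperbolic_group \<beta>)"
  then have p: "real_polynomial_function p"
    and inv: "\<And>k::int. \<And>v. p (hyperbolic_rotation (of_int k * \<beta>) *v v) = p v"
    by (auto simp: invariant_functions_def hyperbolic_group_eq)
  define c d :: "real^2" where "c = vector [1, 1]" and "d = vector [1, -1]"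
  have rot: "hyperbolic_rotation s *v (x *\<^sub>R c + y *\<^sub>R d)
      = exp s *\<^sub>R (x *\<^sub>R c) + inverse (exp s) *\<^sub>R (y *\<^sub>R d)" for s x y
    by (simp add: vec_eq_iff forall_2 matrix_vector_mult_def sum_2 hyperbolic_rotation_def c_def d_def
        cosh_field_def sinh_field_def exp_minus field_simps)
  have const: "p (t *\<^sub>R (x *\<^sub>R c) + inverse t *\<^sub>R (y *\<^sub>R d)) = p (x *\<^sub>R c + y *\<^sub>R d)" if t: "t \<noteq> 0" for x y t
  proof -
    obtain N q where q: "\<And>t. t \<noteq> 0 \<Longrightarrow> t ^ N * p (t *\<^sub>R (x *\<^sub>R c) + inverse t *\<^sub>R (y *\<^sub>R d)) = poly q t"
      using real_polynomial_function_hyperbola[OF p] by blast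
    define r where "r = q - monom (p (x *\<^sub>R c + y *\<^sub>R d)) N"
    have "poly r (exp (of_int k * \<beta>)) = 0" for k :: int
      using q[of "exp (of_int k * \<beta>)"] inv[of k "x *\<^sub>R c + y *\<^sub>R d"]
      by (simp add: r_def poly_monom rot mult.commute)
    then have "range (\<lambda>k::int. exp (of_int k * \<beta>)) \<subseteq> {t. poly r t = 0}" by auto
    moreover have "inj (\<lambda>k::int. exp (of_int k * \<beta>))" using assms by (auto simp: inj_def)
    then have "infinite (range (\<lambda>k::int. exp (of_int k * \<beta>)))"
      using finite_imageD infinite_UNIV_int by blast
    ultimately have "r = 0" using poly_roots_finite finite_subset by blast
    then show ?thesis using q[OF t] t by (simp add: r_def poly_monom)
  qed
  obtain q where q: "\<And>s. p (s *\<^sub>R c + d) = poly q s"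
    using real_polynomial_function_line[OF p] by blast
  define g where "g v = p v - pullback rho (poly (q \<circ>\<^sub>p [:0, 1/4:])) v" for v
  have g: "real_polynomial_function g"
    unfolding g_def[abs_def] by (intro real_polynomial_function_diff p real_polynomial_function_pullback_rho)
  have rho: "rho (x *\<^sub>R c + y *\<^sub>R d) = 4 * (y * x)" for x y
    by (simp add: rho_def c_def d_def power2_eq_square algebra_simps)
  have g0: "g (x *\<^sub>R c + y *\<^sub>R d) = 0" if "y \<noteq> 0" for x y
    using const[OF that, of x y] q[of "y * x"] that
    by (simp add: g_def pullback_def poly_pcompose rho)
  have "g (x *\<^sub>R c + y *\<^sub>R d) = 0" for x y
  proof -
    obtain r where r: "\<And>s. g (s *\<^sub>R d + x *\<^sub>R c) = poly r s"
      using real_polynomial_function_line[OF g] by blast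
    have "- {0} \<subseteq> {s. poly r s = 0}"
      using g0 by (auto simp: add.commute simp flip: r)
    moreover have "infinite (- {0::real})"
      by (simp add: Compl_eq_Diff_UNIV infinite_UNIV_char_0)
    ultimately have "r = 0" using poly_roots_finite finite_subset by blast
    then show ?thesis using r[of y] by (simp add: add.commute)
  qed
  moreover have "v = ((v $ 1 + v $ 2) / 2) *\<^sub>R c + ((v $ 1 - v $ 2) / 2) *\<^sub>R d" for v
    by (simp add: vec_eq_iff forall_2 c_def d_def field_simps)
  ultimately have "g v = 0" for v by metis
  then have "p = pullback rho (poly (q \<circ>\<^sub>p [:0, 1/4:]))" by (auto simp: g_def)
  then show "p \<in> range (\<lambda>q. pullback rho (poly q))" by blast
qed

end

(* The fibre of rho over t > 0 has two branches, x > 0 and x < 0, and the group preserves each of them.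
   With u = x + y and w = x - y one has rho = u w, and the function equal to exp (-1 / (u w)) on the
   quadrant u, w > 0 and to 0 elsewhere is invariant and separates the branches, so it is no pullback.
   It is smooth because its derivatives are combinations of u^(-a) w^(-b) exp (-1 / (u w)), which the
   exponential makes flat along the whole boundary of the quadrant, the origin included. *)
theory Submission
  imports Defs
begin

text \<open>Derivatives are unique, so any explicit \<open>D\<close> may stand in for
  \<open>frechet_derivative\<close> in the recursion.\<close>

lemma class_C_SucI:
  assumes "\<And>x. (f has_derivative D x) (at x)" "\<And>v. class_C n (\<lambda>x. D x v)"
  shows "class_C (Suc n) f"
proof -
  have "frechet_derivative f (at x) = D x" for x
    using frechet_derivative_at[OF assms(1)] by simp
  then show ?thesis using assms by (auto simp: differentiable_def)
qed

lemma class_C_SucD: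
  assumes "class_C (Suc n) f"
  shows "(f has_derivative frechet_derivative f (at x)) (at x)"
    and "class_C n (\<lambda>x. frechet_derivative f (at x) v)"
  using assms by (auto simp: frechet_derivative_works)

text \<open>The product and chain rules leave undifferentiated factors in the derivative; this
  lowers those factors to the class that the induction asks for.\<close>

lemma class_C_Suc_imp: "class_C (Suc n) f \<Longrightarrow> class_C n f"
proof (induction n arbitrary: f)
  case 0
  then show ?case
    by (simp add: continuous_at_imp_continuous_on differentiable_imp_continuous_within)
next
  case (Suc n)
  show ?case
    by (rule class_C_SucI[OF class_C_SucD(1)[OF Suc.prems] Suc.IH[OF class_C_SucD(2)[OF Suc.prems]]])
qed

lemma class_C_const: "class_C n (\<lambda>x. c)"
proof (induction n arbitrary: c)
  case (Suc n)
  show ?case by (rule class_C_SucI[OF has_derivative_const Suc.IH])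
qed simp

lemma class_C_bounded_linear:
  assumes "bounded_linear f"
  shows "class_C n f"
proof (cases n)
  case 0
  then show ?thesis using assms by (simp add: linear_continuous_on)
next
  case (Suc m)
  show ?thesis unfolding Suc
    by (rule class_C_SucI[where D = "\<lambda>x. f"])
       (auto intro: bounded_linear_imp_has_derivative assms class_C_const)
qed

lemma class_C_add:
  "class_C n f \<Longrightarrow> class_C n g \<Longrightarrow> class_C n (\<lambda>x. f x + g x)"
proof (induction n arbitrary: f g)
  case 0
  then show ?case by (simp add: continuous_on_add)
next
  case (Suc n)
  show ?case
    by (rule class_C_SucI[OF has_derivative_add[OF class_C_SucD(1) class_C_SucD(1)]])
       (rule Suc.prems Suc.IH class_C_SucD(2) | assumption)+
qed

lemma class_C_mult:
  "class_C n f \<Longrightarrow> class_C n g \<Longrightarrow> class_C n (\<lambda>x. f x * g x)"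
proof (induction n arbitrary: f g)
  case 0
  then show ?case by (simp add: continuous_on_mult)
next
  case (Suc n)
  show ?case
    by (rule class_C_SucI[OF has_derivative_mult[OF class_C_SucD(1) class_C_SucD(1)]])
       (rule Suc.prems class_C_add Suc.IH class_C_SucD(2)[OF Suc.prems(1)]
          class_C_SucD(2)[OF Suc.prems(2)] class_C_Suc_imp)+
qed

lemma class_C_diff:
  "class_C n f \<Longrightarrow> class_C n g \<Longrightarrow> class_C n (\<lambda>x. f x - g x)"
  using class_C_add[of n f "\<lambda>x. (-1) * g x"] class_C_mult[OF class_C_const, of n g "-1"] by simp

text \<open>The derivative of \<open>f\<close> is multiplication by a number, so the composite has
  as derivative the product of that of \<open>g\<close> with the composite of f' and the same
  \<open>g\<close>. Hence \<open>f\<close> varies in the induction while \<open>g\<close> stays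
  fixed.\<close>

lemma class_C_compose:
  fixes f :: "real \<Rightarrow> real"
  shows "class_C n f \<Longrightarrow> class_C n g \<Longrightarrow> class_C n (\<lambda>x. f (g x))"
proof (induction n arbitrary: f)
  case 0
  then show ?case using continuous_on_compose2[of UNIV f UNIV g] by simp
next
  case (Suc n)
  note g' = class_C_SucD[OF Suc.prems(2)]
  have D: "((\<lambda>x. f (g x)) has_derivative
      (\<lambda>v. frechet_derivative g (at x) v * frechet_derivative f (at (g x)) 1)) (at x)" for x
  proof -
    interpret linear "frechet_derivative f (at (g x))"
      using class_C_SucD(1)[OF Suc.prems(1)] by (rule has_derivative_linear)
    have "frechet_derivative f (at (g x)) t = t * frechet_derivative f (at (g x)) 1" for t
      using scale[of t 1] by simp
    then show ?thesis
      by (intro has_derivative_eq_rhs[OF has_derivative_compose[OF g'(1) class_C_SucD(1)[OF Suc.prems(1)]]] ext)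
  qed
  show ?case
    by (rule class_C_SucI[OF D class_C_mult[OF g'(2)
          Suc.IH[OF class_C_SucD(2)[OF Suc.prems(1)] class_C_Suc_imp[OF Suc.prems(2)]]]])
qed

text \<open>The exponents are carried along because differentiation raises them: for linear
  \<open>u\<close> and \<open>w\<close>, directional derivatives stay in the linear span of the
  family.\<close>

definition quadrant_bump :: "('a \<Rightarrow> real) \<Rightarrow> ('a \<Rightarrow> real) \<Rightarrow> nat \<Rightarrow> nat \<Rightarrow> 'a \<Rightarrow> real" where
  "quadrant_bump u w a b x =
     (if 0 < u x \<and> 0 < w x then inverse (u x) ^ a * inverse (w x) ^ b * exp (- (inverse (u x) * inverse (w x))) else 0)"

text \<open>By this symmetry, flatness has to be proved only where \<open>u\<close> is
  nonpositive.\<close>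

lemma quadrant_bump_commute: "quadrant_bump u w a b = quadrant_bump w u b a"
  by (auto simp: quadrant_bump_def fun_eq_iff mult_ac)

(* The exponential series gives exp (- s) \<le> n! / s^n; n = a + b + 2 leaves positive powers of u and w. *)
lemma quadrant_bump_le:
  "quadrant_bump u w a b x \<le> fact (a + b + 2) * (max 0 (u x) ^ (b + 2) * max 0 (w x) ^ (a + 2))"
proof (cases "0 < u x \<and> 0 < w x")
  case True
  define p q where "p = u x" and "q = w x"
  have pos: "0 < p" "0 < q" using True by (auto simp: p_def q_def)
  define n where "n = a + b + 2"
  have "(inverse p * inverse q) ^ n / fact n \<le> exp (inverse p * inverse q)"
    using sum_le_suminf[OF summable_exp, of "{n}" "inverse p * inverse q"] pos
    by (simp add: exp_def divide_inverse mult.commute)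
  then have "exp (- (inverse p * inverse q)) \<le> fact n * (p * q) ^ n"
    using pos by (simp add: exp_minus field_simps)
  then have "inverse p ^ a * inverse q ^ b * exp (- (inverse p * inverse q))
      \<le> inverse p ^ a * inverse q ^ b * (fact n * (p * q) ^ n)"
    using pos by (intro mult_left_mono) auto
  also have "\<dots> = fact n * (p ^ (b + 2) * q ^ (a + 2))"
    using pos by (simp add: n_def power_add field_simps)
  finally show ?thesis using True by (simp add: quadrant_bump_def p_def q_def n_def)
qed (auto simp: quadrant_bump_def)

lemma quadrant_bump_nonneg: "0 \<le> quadrant_bump u w a b x"
  by (simp add: quadrant_bump_def)

text \<open>The function vanishes at \<open>p\<close>, and its difference quotient is squeezed
  between 0 and a continuous \<open>R\<close> with \<open>R p = 0\<close>. The sign of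
  \<open>w p\<close> does not matter, so the origin is covered.\<close>

lemma quadrant_bump_flat:
  fixes u w :: "'a::euclidean_space \<Rightarrow> real"
  assumes u: "bounded_linear u" and w: "bounded_linear w" and p: "u p \<le> 0"
  shows "(quadrant_bump u w a b has_derivative (\<lambda>v. 0)) (at p)"
proof -
  interpret u: bounded_linear u by (rule u)
  obtain B where B: "\<And>x. norm (u x) \<le> norm x * B" and "0 < B" using u.pos_bounded by blast
  \<comment> \<open>Of the \<open>b + 2\<close> factors \<open>max 0 (u y)\<close> in
    \<open>quadrant_bump_le\<close>, one is traded for \<open>B * norm (y - p)\<close>; at least one
    remains and makes \<open>R\<close> vanish at \<open>p\<close>.\<close>
  define R where "R y = fact (a + b + 2) * (B * max 0 (u y) ^ (b + 1) * max 0 (w y) ^ (a + 2))" for y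
  \<comment> \<open>From \<open>u p \<le> 0\<close> and linearity,
    \<open>u y \<le> u (y - p)\<close>.\<close>
  have max: "max 0 (u y) \<le> B * norm (y - p)" for y
    using B[of "y - p"] p \<open>0 < B\<close> by (auto simp: u.diff mult.commute)
  have le: "quadrant_bump u w a b y \<le> norm (y - p) * R y" for y
  proof -
    have "max 0 (u y) * (max 0 (u y) ^ (b + 1) * max 0 (w y) ^ (a + 2))
        \<le> B * norm (y - p) * (max 0 (u y) ^ (b + 1) * max 0 (w y) ^ (a + 2))"
      by (rule mult_right_mono[OF max]) auto
    from mult_left_mono[OF this, of "fact (a + b + 2)"]
    have "fact (a + b + 2) * (max 0 (u y) ^ (b + 2) * max 0 (w y) ^ (a + 2)) \<le> norm (y - p) * R y"
      by (simp add: R_def mult_ac del: fact_Suc)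
    then show ?thesis using quadrant_bump_le[of u w a b y] by linarith
  qed
  have "isCont R p"
    unfolding R_def[abs_def]
    by (intro continuous_intros linear_continuous_at u w)
  moreover have "R p = 0" using p by (simp add: R_def max_def)
  ultimately have R: "(R \<longlongrightarrow> 0) (at p)" by (simp add: isCont_def)
  have "((\<lambda>y. norm (quadrant_bump u w a b y - quadrant_bump u w a b p - 0) / norm (y - p)) \<longlongrightarrow> 0) (at p)"
  proof (rule tendsto_sandwich[OF _ _ tendsto_const R])
    have "quadrant_bump u w a b p = 0" using p by (simp add: quadrant_bump_def)
    then show "\<forall>\<^sub>F y in at p. norm (quadrant_bump u w a b y - quadrant_bump u w a b p - 0) / norm (y - p) \<le> R y"
      using le quadrant_bump_nonneg[of u w a b]
      by (auto simp: eventually_at_filter divide_le_eq mult.commute)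
  qed auto
  then show ?thesis by (simp add: has_derivative_iff_norm)
qed

text \<open>In each bracket the first term comes from the exponential and the second from the
  inverse power. The coefficients \<open>u v\<close> and \<open>w v\<close> do not depend on
  \<open>x\<close>.\<close>

definition quadrant_bump_derivative ::
  "('a \<Rightarrow> real) \<Rightarrow> ('a \<Rightarrow> real) \<Rightarrow> nat \<Rightarrow> nat \<Rightarrow> 'a \<Rightarrow> 'a \<Rightarrow> real" where
  "quadrant_bump_derivative u w a b x v =
     u v * (quadrant_bump u w (a + 2) (b + 1) x - of_nat a * quadrant_bump u w (a + 1) b x) +
     w v * (quadrant_bump u w (a + 1) (b + 2) x - of_nat b * quadrant_bump u w a (b + 1) x)"

lemma has_derivative_quadrant_bump:
  fixes u w :: "'a::euclidean_space \<Rightarrow> real"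
  assumes u: "bounded_linear u" and w: "bounded_linear w"
  shows "(quadrant_bump u w a b has_derivative quadrant_bump_derivative u w a b p) (at p)"
proof (cases "0 < u p \<and> 0 < w p")
  case False
  then have "quadrant_bump_derivative u w a b p = (\<lambda>v. 0)"
    by (auto simp: quadrant_bump_derivative_def quadrant_bump_def)
  moreover have "(quadrant_bump u w a b has_derivative (\<lambda>v. 0)) (at p)"
    using False quadrant_bump_flat[OF u w] quadrant_bump_flat[OF w u] quadrant_bump_commute
    by (metis not_less)
  ultimately show ?thesis by simp
next
  case True
  define g where "g x = inverse (u x) ^ a * inverse (w x) ^ b * exp (- (inverse (u x) * inverse (w x)))" for x
  \<comment> \<open>The power rule has the truncated exponent \<open>n - 1\<close>, so
    \<open>n = 0\<close> is split off.\<close>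
  have d: "DERIV (\<lambda>t. inverse t ^ n) t :> - (of_nat n * inverse t ^ (n + 1))" if "t > 0" for n and t :: real
    using that DERIV_power[OF DERIV_inverse[of t], of n]
    by (cases n) (auto simp: mult_ac)
  have dn: "((\<lambda>x. inverse (l x) ^ n) has_derivative (\<lambda>v. - (of_nat n * inverse (l p) ^ (n + 1)) * l v)) (at p)"
    if "bounded_linear l" "l p > 0" for l :: "'a \<Rightarrow> real" and n
    using has_derivative_compose[OF bounded_linear_imp_has_derivative[OF that(1)]
        d[OF that(2), unfolded has_field_derivative_def]] .
  note du = dn[OF u conjunct1[OF True]] and dw = dn[OF w conjunct2[OF True]]
  have "(g has_derivative quadrant_bump_derivative u w a b p) (at p)"
    unfolding g_def[abs_def]
    by (rule has_derivative_eq_rhs,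
        rule has_derivative_mult[OF has_derivative_mult[OF du dw] has_derivative_exp[OF
          has_derivative_minus[OF has_derivative_mult[OF du[of 1, simplified power_one_right]
            dw[of 1, simplified power_one_right]]]]])
       (use True in \<open>auto simp: quadrant_bump_derivative_def quadrant_bump_def fun_eq_iff algebra_simps\<close>)
  \<comment> \<open>The formula \<open>g\<close> agrees with the bump only inside the quadrant;
    openness lets the derivative carry over.\<close>
  moreover have "open {x. 0 < u x \<and> 0 < w x}"
    by (intro open_Collect_conj open_Collect_less continuous_intros linear_continuous_on u w)
  ultimately show ?thesis
    using True by (elim has_derivative_transform_within_open) (auto simp: g_def quadrant_bump_def)
qed

text \<open>The induction runs over all exponents at once, since the derivative combines members of
  the family with larger ones.\<close>

lemma class_C_quadrant_bump:
  fixes u w :: "'a::euclidean_space \<Rightarrow> real"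
  assumes u: "bounded_linear u" and w: "bounded_linear w"
  shows "class_C n (quadrant_bump u w a b)"
proof (induction n arbitrary: a b)
  case 0
  show ?case
    using has_derivative_continuous[OF has_derivative_quadrant_bump[OF u w]]
    by (simp add: continuous_at_imp_continuous_on)
next
  case (Suc n)
  show ?case
    by (rule class_C_SucI[OF has_derivative_quadrant_bump[OF u w]])
       (unfold quadrant_bump_derivative_def, intro class_C_add class_C_mult class_C_diff class_C_const Suc)
qed

lemma smooth_rho: "rho \<in> smooth_functions"
proof -
  have nth: "class_C n (\<lambda>v::real^2. v $ i)" for n i
    by (rule class_C_bounded_linear[OF bounded_linear_vec_nth])
  have "class_C n rho" for n
    unfolding rho_def[abs_def] power2_eq_square
    by (rule class_C_diff[OF class_C_mult[OF nth nth] class_C_mult[OF nth nth]])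
  then show ?thesis by (simp add: smooth_functions_def)
qed

lemma pullback_smooth:
  fixes \<phi> :: "'a::euclidean_space \<Rightarrow> real"
  assumes "\<phi> \<in> smooth_functions" "f \<in> smooth_functions"
  shows "pullback \<phi> f \<in> smooth_functions"
proof -
  have "class_C n (\<lambda>x. f (\<phi> x))" for n
    using assms unfolding smooth_functions_def by (intro class_C_compose[of n f \<phi>]) blast+
  then show ?thesis by (simp add: smooth_functions_def pullback_def comp_def)
qed

text \<open>Zero exponents leave the bare exponential; the two forms are the null coordinates, with
  product \<open>rho\<close>.\<close>

definition one_branch :: "real^2 \<Rightarrow> real" where
  "one_branch = quadrant_bump (\<lambda>v. v $ 1 + v $ 2) (\<lambda>v. v $ 1 - v $ 2) 0 0"

lemma one_branch_smooth: "one_branch \<in> smooth_functions"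
  unfolding smooth_functions_def one_branch_def
  using class_C_quadrant_bump[OF bounded_linear_add[OF bounded_linear_vec_nth bounded_linear_vec_nth]
      bounded_linear_sub[OF bounded_linear_vec_nth bounded_linear_vec_nth]]
  by blast

text \<open>A rotation scales the null coordinates by \<open>exp s\<close> and its inverse, which
  preserves their signs and their product.\<close>

lemma one_branch_rotation: "one_branch (hyperbolic_rotation s *v v) = one_branch v"
proof -
  let ?h = "hyperbolic_rotation s *v v"
  have "?h $ 1 + ?h $ 2 = exp s * (v $ 1 + v $ 2)"
    and "?h $ 1 - ?h $ 2 = inverse (exp s) * (v $ 1 - v $ 2)"
    by (simp_all add: matrix_vector_mult_def sum_2 hyperbolic_rotation_def
        cosh_field_def sinh_field_def exp_minus field_simps)
  then show ?thesis
    by (simp add: one_branch_def quadrant_bump_def zero_less_mult_iff)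
qed

text \<open>The points (1, 0) and (-1, 0) share the value 1 of \<open>rho\<close> but lie on
  different branches, where the function is \<open>exp (-1)\<close> and 0.\<close>

lemma one_branch_not_pullback: "one_branch \<noteq> pullback rho f"
proof
  assume eq: "one_branch = pullback rho f"
  have "one_branch (vector [1, 0]) = one_branch (vector [-1, 0])"
    by (simp add: eq pullback_def rho_def)
  then show False by (simp add: one_branch_def quadrant_bump_def)
qed

theorem proposition4p1:
  fixes \<beta> :: real
  assumes "\<beta> \<noteq> 0"
  shows "pullback rho ` smooth_functions \<subset> smooth_functions \<inter> invariant_functions (hyperbolic_group \<beta>)"
proof
  show "pullback rho ` smooth_functions \<subseteq> smooth_functions \<inter> invariant_functions (hyperbolic_group \<beta>)"
    using pullback_smooth[OF smooth_rho] pullback_rho_invariant by auto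
  have "one_branch \<in> smooth_functions \<inter> invariant_functions (hyperbolic_group \<beta>)"
    using one_branch_smooth one_branch_rotation
    by (auto simp: invariant_functions_def hyperbolic_group_eq)
  then show "pullback rho ` smooth_functions \<noteq> smooth_functions \<inter> invariant_functions (hyperbolic_group \<beta>)"
    using one_branch_not_pullback by auto
qed

end
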